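(* The integrality gap of the relaxation obtained from (LP-classic) with the addition of the effective capacity inequalities is unbounded, even for uniform capacitated facility location (CFL) with unit demands.
   Context: CFL: facilities $F$ with opening costs $f_i$ and capacities $u_i$ (uniform: all equal to $U$), clients $C$ with demands $d_j$, metric connection costs $c_{ij}$; open facilities and assign clients to open facilities respecting capacities, minimizing total cost. (LP-classic): minimize $\sum_i f_iy_i+\sum_{i,j}c_{ij}x_{ij}$ subject to $x_{ij}\le y_i$, $\sum_i x_{ij}=1$ for all $j$, $\sum_j x_{ij}\le Uy_i$ for all $i$, $0\le y_i,x_{ij}\le1$. Effective capacity inequalities: for $J\subseteq C$, $I\subseteq F$, and $J_i\subseteq J$ for each $i\in I$, let $d(J)=\sum_{j\in J}d_j$ and $\bar u_i=\min\{u_i,d(J_i)\}$; if $\sum_{i\in I}\bar u_i=d(J)+\lambda$ with $\lambda>0$ and $\max_{i\in I}\bar u_i>\lambda$, then $\sum_{i\in I}\sum_{j\in J_i}d_jx_{ij}+\sum_{i\in I}(\bar u_i-\lambda)^+(1-y_i)\le d(J)$ is valid. These generalize the flow-cover inequalities (the case $J_i=J$ for all $i$). *)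

theory Defs
  imports "HOL-Analysis.Abstract_Metric_Spaces" "HOL-Library.Extended_Real"
begin

text \<open>
  Facilities and clients are named by natural numbers. The two name spaces are independent:
  facility 0 and client 0 are different objects. Hence every finite instance is
  isomorphic to one of this type.
\<close>

record cfl =
  facilities :: "nat set"
  clients :: "nat set"
  open_cost :: "nat \<Rightarrow> real"
  capacity :: "nat \<Rightarrow> real"
  demand :: "nat \<Rightarrow> real"
  conn :: "nat \<Rightarrow> nat \<Rightarrow> real"

text \<open>
  The connection costs are the facility-client distances of a metric on the disjoint
  union of facilities and clients. The metric is a genuine one, i.e. distinct points have positive
  distance. Admitting co-located points would only enlarge the class of instances, hence
  could only increase the integrality gap.
\<close>

definition metric_costs :: "cfl \<Rightarrow> bool" where
  "metric_costs A \<longleftrightarrow>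
    (\<exists>D. Metric_space (facilities A <+> clients A) D \<and>
         (\<forall>i\<in>facilities A. \<forall>j\<in>clients A. conn A i j = D (Inl i) (Inr j)))"

definition cfl_instance :: "cfl \<Rightarrow> bool" where
  "cfl_instance A \<longleftrightarrow>
    finite (facilities A) \<and> finite (clients A) \<and>
    (\<forall>i\<in>facilities A. open_cost A i \<ge> 0 \<and> capacity A i > 0) \<and>
    (\<forall>j\<in>clients A. demand A j > 0) \<and>
    metric_costs A"

text \<open>
  The common capacity is a positive integer. For unit demands it is then immaterial whether
  a client may be split among several open facilities, and no gap can arise merely from
  rounding down a fractional capacity.
\<close>

definition uniform_unit_cfl :: "cfl \<Rightarrow> bool" where
  "uniform_unit_cfl A \<longleftrightarrow>
    cfl_instance A \<and>
    (\<exists>U::nat. U > 0 \<and> (\<forall>i\<in>facilities A. capacity A i = real U)) \<and>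
    (\<forall>j\<in>clients A. demand A j = 1)"

definition cfl_solution :: "cfl \<Rightarrow> nat set \<Rightarrow> (nat \<Rightarrow> nat) \<Rightarrow> bool" where
  "cfl_solution A S \<sigma> \<longleftrightarrow>
    S \<subseteq> facilities A \<and>
    (\<forall>j\<in>clients A. \<sigma> j \<in> S) \<and>
    (\<forall>i\<in>S. (\<Sum>j\<in>{j\<in>clients A. \<sigma> j = i}. demand A j) \<le> capacity A i)"

text \<open>
  As in the linear program below, the connection cost is paid once per client, irrespective of its
  demand.
\<close>

definition cfl_cost :: "cfl \<Rightarrow> nat set \<Rightarrow> (nat \<Rightarrow> nat) \<Rightarrow> real" where
  "cfl_cost A S \<sigma> = (\<Sum>i\<in>S. open_cost A i) + (\<Sum>j\<in>clients A. conn A (\<sigma> j) j)"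

definition cfl_opt :: "cfl \<Rightarrow> ereal" where
  "cfl_opt A = Inf {ereal (cfl_cost A S \<sigma>) | S \<sigma>. cfl_solution A S \<sigma>}"

text \<open>
  In the linear programs, \<open>x i j\<close> is the fraction of client \<open>j\<close> assigned to facility \<open>i\<close>.
  For unit demands and a common capacity \<open>U\<close> the capacity constraint below is
  \<open>(\<Sum>j. x i j) \<le> U * y i\<close>.
\<close>

definition lp_classic :: "cfl \<Rightarrow> (nat \<Rightarrow> nat \<Rightarrow> real) \<Rightarrow> (nat \<Rightarrow> real) \<Rightarrow> bool" where
  "lp_classic A x y \<longleftrightarrow>
    (\<forall>i\<in>facilities A. \<forall>j\<in>clients A. x i j \<le> y i) \<and>
    (\<forall>j\<in>clients A. (\<Sum>i\<in>facilities A. x i j) = 1) \<and>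
    (\<forall>i\<in>facilities A. (\<Sum>j\<in>clients A. demand A j * x i j) \<le> capacity A i * y i) \<and>
    (\<forall>i\<in>facilities A. 0 \<le> y i \<and> y i \<le> 1) \<and>
    (\<forall>i\<in>facilities A. \<forall>j\<in>clients A. 0 \<le> x i j \<and> x i j \<le> 1)"

definition lp_cost :: "cfl \<Rightarrow> (nat \<Rightarrow> nat \<Rightarrow> real) \<Rightarrow> (nat \<Rightarrow> real) \<Rightarrow> real" where
  "lp_cost A x y =
    (\<Sum>i\<in>facilities A. open_cost A i * y i) +
    (\<Sum>i\<in>facilities A. \<Sum>j\<in>clients A. conn A i j * x i j)"

definition total_demand :: "cfl \<Rightarrow> nat set \<Rightarrow> real" where
  "total_demand A J = (\<Sum>j\<in>J. demand A j)"

definition eff_cap :: "cfl \<Rightarrow> (nat \<Rightarrow> nat set) \<Rightarrow> nat \<Rightarrow> real" where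
  "eff_cap A Js i = min (capacity A i) (total_demand A (Js i))"

definition eff_cap_ineqs :: "cfl \<Rightarrow> (nat \<Rightarrow> nat \<Rightarrow> real) \<Rightarrow> (nat \<Rightarrow> real) \<Rightarrow> bool" where
  "eff_cap_ineqs A x y \<longleftrightarrow>
    (\<forall>J I Js l.
      J \<subseteq> clients A \<and> I \<subseteq> facilities A \<and> (\<forall>i\<in>I. Js i \<subseteq> J) \<and>
      (\<Sum>i\<in>I. eff_cap A Js i) = total_demand A J + l \<and>
      l > 0 \<and> Max (eff_cap A Js ` I) > l \<longrightarrow>
      (\<Sum>i\<in>I. \<Sum>j\<in>Js i. demand A j * x i j) +
      (\<Sum>i\<in>I. max 0 (eff_cap A Js i - l) * (1 - y i)) \<le> total_demand A J)"

definition eff_cap_relaxation :: "cfl \<Rightarrow> (nat \<Rightarrow> nat \<Rightarrow> real) \<Rightarrow> (nat \<Rightarrow> real) \<Rightarrow> bool" where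
  "eff_cap_relaxation A x y \<longleftrightarrow> lp_classic A x y \<and> eff_cap_ineqs A x y"

definition relaxation_opt ::
    "(cfl \<Rightarrow> (nat \<Rightarrow> nat \<Rightarrow> real) \<Rightarrow> (nat \<Rightarrow> real) \<Rightarrow> bool) \<Rightarrow> cfl \<Rightarrow> ereal" where
  "relaxation_opt R A = Inf {ereal (lp_cost A x y) | x y. R A x y}"

text \<open>
  The supremum of the ratio of the two optima. Infeasible instances, and
  instances for which the relaxation has value 0, are excluded, so that an infinite gap is never
  due to a single degenerate instance with ratio \<open>\<infinity>\<close>.
\<close>

definition integrality_gap ::
    "(cfl \<Rightarrow> (nat \<Rightarrow> nat \<Rightarrow> real) \<Rightarrow> (nat \<Rightarrow> real) \<Rightarrow> bool) \<Rightarrow> cfl set \<Rightarrow> ereal" where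
  "integrality_gap R K =
    (SUP A \<in> {A \<in> K. (\<exists>S \<sigma>. cfl_solution A S \<sigma>) \<and> relaxation_opt R A > 0}.
      cfl_opt A / relaxation_opt R A)"

end

theory Submission
  imports Defs
begin

text \<open>
  Let \<open>m = q\<^sup>2\<close> clusters be placed at the points \<open>0, \<dots>, m - 1\<close> of a line. Each has \<open>m\<close> clients, a
  free facility and a costly one of cost \<open>m\<close>; all capacities are \<open>m - 1\<close>. So every cluster has one
  client too many: either a costly facility is opened for about every \<open>q\<close> clusters, or clients travel
  distance about \<open>q\<close> on average, and an integral solution costs at least \<open>q\<^sup>3 / 2\<close>.

  Fractionally, a costly facility is opened to the extent \<open>2 / (m - 1)\<close> and serves one unit of demand
  of its own cluster, while each free facility leaves two units of its own cluster to others and serves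
  two units of the next cluster in cyclic order instead. This costs at most \<open>8 m\<close>. The effective capacity inequalities do not
  notice that the exchange is a mere circulation: they only see the demand that leaves a set of
  clusters, and connectedness of the cycle makes this large for every proper subset.
\<close>

text \<open>
  Facility \<open>k < m\<close> is the free facility of cluster \<open>k\<close>, facility \<open>m + k\<close> the costly one. Client \<open>j\<close>
  belongs to cluster \<open>j div m\<close>. The summand \<open>1 / m\<close> in the connection cost keeps co-located points
  at positive distance.
\<close>

definition gap_cfl :: "nat \<Rightarrow> cfl" where
  "gap_cfl m = \<lparr>facilities = {..<2 * m}, clients = {..<m * m},
     open_cost = (\<lambda>i. if i < m then 0 else real m),
     capacity = (\<lambda>_. real (m - 1)), demand = (\<lambda>_. 1),
     conn = (\<lambda>i j. 1 / real m + \<bar>real (i mod m) - real (j div m)\<bar>)\<rparr>"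

text \<open>\<open>flow m k l\<close> is the total demand of cluster \<open>l\<close> served by the free facility of cluster \<open>k\<close>.\<close>

definition flow :: "nat \<Rightarrow> nat \<Rightarrow> nat \<Rightarrow> real" where
  "flow m k l = (if k = l then real m - 3 else 0) + (if Suc k mod m = l then 2 else 0)"

text \<open>Demand is spread evenly over the \<open>m\<close> clients of a cluster, so a bound on
  the load from a set of clients follows from its size alone.\<close>

definition gap_x :: "nat \<Rightarrow> nat \<Rightarrow> nat \<Rightarrow> real" where
  "gap_x m i j =
     (if i < m then flow m i (j div m) / real m
      else if i - m = j div m then 1 / real m else 0)"

text \<open>A costly facility carries load 1, for which \<open>1 / (m - 1)\<close> would meet the
  capacity constraint. The factor 2 makes its fractional opening pay for this load in an effective
  capacity inequality when \<open>l\<close> is at most half of its effective capacity.\<close>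

definition gap_y :: "nat \<Rightarrow> nat \<Rightarrow> real" where
  "gap_y m i = (if i < m then 1 else 2 / (real m - 1))"

lemma gap_cfl_simps [simp]:
  "facilities (gap_cfl m) = {..<2 * m}"
  "clients (gap_cfl m) = {..<m * m}"
  "open_cost (gap_cfl m) i = (if i < m then 0 else real m)"
  "capacity (gap_cfl m) i = real (m - 1)"
  "demand (gap_cfl m) j = 1"
  "conn (gap_cfl m) i j = 1 / real m + \<bar>real (i mod m) - real (j div m)\<bar>"
  by (simp_all add: gap_cfl_def)

section \<open>Sums over clusters and facilities\<close>

lemma cluster_less: "j < m * m \<Longrightarrow> j div m < (m::nat)"
  by (simp add: less_mult_imp_div_less)

lemma sum_clusters:
  fixes g :: "nat \<Rightarrow> real"
  shows "(\<Sum>j<m * m. g (j div m)) = real m * (\<Sum>k<m. g k)"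
proof (cases "m = 0")
  case False
  have "(\<Sum>j<m * m. g (j div m)) = (\<Sum>k<m. \<Sum>j=k*m..<k*m+m. g (j div m))"
    by (rule sum.nat_group[symmetric])
  also have "\<dots> = (\<Sum>k<m. \<Sum>j=k*m..<k*m+m. g k)"
  proof (intro sum.cong refl)
    fix k j assume "j \<in> {k*m..<k*m+m}"
    then have "j div m = k"
      using div_nat_eqI[of m k j] by (simp add: mult.commute)
    then show "g (j div m) = g k" by simp
  qed
  finally show ?thesis by (simp add: sum_distrib_left)
qed simp

lemma sum_facilities:
  fixes g :: "nat \<Rightarrow> real"
  shows "(\<Sum>i<2 * m. g i) = (\<Sum>k<m. g k) + (\<Sum>k<m. g (m + k))"
proof -
  have "(\<Sum>i<2 * m. g i) = (\<Sum>i<m. g i) + (\<Sum>i=m..<2*m. g i)"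
    by (subst sum.atLeastLessThan_concat[of 0 m "2*m", symmetric, simplified atLeast0LessThan]) auto
  also have "(\<Sum>i=m..<2*m. g i) = (\<Sum>k<m. g (m + k))"
    using sum.shift_bounds_nat_ivl[of g 0 m m] by (simp add: atLeast0LessThan mult_2 add.commute)
  finally show ?thesis .
qed

section \<open>The flow and the classic relaxation\<close>

lemma flow_nonneg: "3 \<le> m \<Longrightarrow> 0 \<le> flow m k l"
  by (simp add: flow_def)

lemma Suc_mod_neq: "2 \<le> m \<Longrightarrow> k < m \<Longrightarrow> Suc k mod m \<noteq> k"
  by (cases "Suc k = m") auto

text \<open>The two summands of \<open>flow\<close> never meet, and \<open>5 \<le> m\<close> gives
  \<open>2 \<le> m - 3\<close>.\<close>

lemma flow_le: "5 \<le> m \<Longrightarrow> k < m \<Longrightarrow> flow m k l \<le> real m - 3"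
  using Suc_mod_neq[of m k] by (auto simp: flow_def)

lemma flow_row:
  assumes "k < m"
  shows "(\<Sum>l<m. flow m k l) = real m - 1"
proof -
  have "Suc k mod m < m" using assms by (intro mod_less_divisor) simp
  then show ?thesis
    unfolding flow_def sum.distrib sum.delta'[OF finite_lessThan] lessThan_iff
    by (simp only: assms if_True)
qed

text \<open>Each cluster gets \<open>m - 3\<close> from its own free facility and 2 from its
  predecessor on the cycle. The one missing unit is left to its costly facility.\<close>

lemma flow_col:
  assumes "3 \<le> m" "l < m"
  shows "(\<Sum>k<m. flow m k l) = real m - 1"
proof -
  have "Suc k mod m = l \<longleftrightarrow> k = (if l = 0 then m - 1 else l - 1)" if "k < m" for k
    using that assms by (cases "Suc k = m") auto
  then have "(\<Sum>k<m. if Suc k mod m = l then 2 else 0) =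
      (\<Sum>k<m. if k = (if l = 0 then m - 1 else l - 1) then 2 else (0::real))"
    by (intro sum.cong) auto
  also have "\<dots> = 2"
    using assms by (subst sum.delta) auto
  finally show ?thesis
    using assms by (simp add: flow_def sum.distrib)
qed

lemma gap_x_nonneg: "3 \<le> m \<Longrightarrow> 0 \<le> gap_x m i j"
  by (simp add: gap_x_def flow_nonneg)

lemma gap_x_free_le:
  assumes "5 \<le> m" "i < m"
  shows "gap_x m i j \<le> 1 - 3 / real m"
  using flow_le[OF assms, of "j div m"] assms by (simp add: gap_x_def field_simps)

lemma gap_x_costly_le: "\<not> i < m \<Longrightarrow> gap_x m i j \<le> 1 / real m"
  by (simp add: gap_x_def)

lemma gap_x_client:
  assumes "3 \<le> m" "j < m * m"
  shows "(\<Sum>i<2 * m. gap_x m i j) = 1"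
proof -
  have l: "j div m < m" using assms(2) by (rule cluster_less)
  have "(\<Sum>i<2 * m. gap_x m i j) = (\<Sum>k<m. flow m k (j div m)) / real m + 1 / real m"
    using l by (simp add: sum_facilities gap_x_def sum_divide_distrib)
  also have "\<dots> = 1"
    using flow_col[OF assms(1) l] assms(1) by (simp add: field_simps)
  finally show ?thesis .
qed

lemma gap_x_free_load:
  assumes "3 \<le> m" "i < m"
  shows "(\<Sum>j<m * m. gap_x m i j) = real m - 1"
proof -
  have "(\<Sum>j<m * m. gap_x m i j) = (\<Sum>j<m * m. flow m i (j div m) / real m)"
    using assms(2) by (simp only: gap_x_def if_True)
  also have "\<dots> = real m * (\<Sum>l<m. flow m i l / real m)"
    by (rule sum_clusters)
  also have "\<dots> = (\<Sum>l<m. flow m i l)"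
    using assms(1) by (simp flip: sum_divide_distrib)
  finally show ?thesis using flow_row[OF assms(2)] by simp
qed

lemma gap_x_costly_load:
  assumes "m \<le> i" "i < 2 * m"
  shows "(\<Sum>j<m * m. gap_x m i j) = 1"
proof -
  have "(\<Sum>j<m * m. gap_x m i j) = (\<Sum>j<m * m. if i - m = j div m then 1 / real m else 0)"
    using assms(1) by (simp add: gap_x_def)
  also have "\<dots> = real m * (\<Sum>l<m. if i - m = l then 1 / real m else 0)"
    by (rule sum_clusters)
  also have "\<dots> = 1"
    using assms by (simp add: sum.delta'[OF finite_lessThan])
  finally show ?thesis .
qed

lemma lp_classic_gap:
  assumes "5 \<le> m"
  shows "lp_classic (gap_cfl m) (gap_x m) (gap_y m)"
proof -
  have m: "3 \<le> m" using assms by simp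
  have y: "1 / real m \<le> 2 / (real m - 1)" "2 / (real m - 1) \<le> 1" "0 \<le> 2 / (real m - 1)"
    using assms by (simp_all add: field_simps)
  have xy: "gap_x m i j \<le> gap_y m i" for i j
  proof (cases "i < m")
    case True
    have "gap_x m i j \<le> 1 - 3 / real m"
      by (rule gap_x_free_le[OF assms True])
    also have "\<dots> \<le> 1" by simp
    finally show ?thesis using True by (simp add: gap_y_def)
  next
    case False
    then show ?thesis
      using gap_x_costly_le[OF False, of j] y by (simp add: gap_y_def)
  qed
  have y1: "0 \<le> gap_y m i" "gap_y m i \<le> 1" for i
    using y by (auto simp: gap_y_def)
  have load: "(\<Sum>j<m * m. gap_x m i j) \<le> real (m - 1) * gap_y m i" if "i < 2 * m" for i
    using that assms gap_x_free_load[OF m, of i] gap_x_costly_load[of m i]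
    by (cases "i < m") (simp_all add: gap_y_def of_nat_diff)
  show ?thesis
    unfolding lp_classic_def
    using xy y1 load gap_x_client[OF m] gap_x_nonneg[OF m] order_trans[OF xy y1(2)] by simp
qed

section \<open>The effective capacity inequalities\<close>

lemma Suc_mod_closed_imp_all:
  assumes T: "T \<subseteq> {..<m}" "T \<noteq> {}" and closed: "\<And>k. k \<in> T \<Longrightarrow> Suc k mod m \<in> T"
  shows "T = {..<m}"
proof -
  obtain k where k: "k \<in> T" "k < m" using T by auto
  have shift: "(k + n) mod m \<in> T" for n
  proof (induction n)
    case 0
    show ?case using k by simp
  next
    case (Suc n)
    show ?case using closed[OF Suc.IH] by (simp add: mod_Suc_eq)
  qed
  have "l \<in> T" if "l < m" for l
    \<comment> \<open>Going \<open>l + m - k\<close> steps from \<open>k\<close> ends at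
      \<open>l + m\<close>; adding \<open>m\<close> first keeps the subtraction exact.\<close>
    using shift[of "l + m - k"] that k by simp
  then show ?thesis using T(1) by auto
qed

text \<open>A proper nonempty \<open>T\<close> is not closed under the successor, so it sends flow
  to at least one further cluster, and \<open>card Q\<close> exceeds \<open>card T\<close>. For the
  whole cycle the bound is the equation \<open>m + m * (m - 1) = m * m\<close>.\<close>

lemma expanding_clusters:
  assumes "5 \<le> m" and T: "T \<subseteq> {..<m}" "T \<noteq> {}"
  obtains Q where "Q \<subseteq> {..<m}" "m + card T * (m - 1) \<le> m * card Q"
    "\<And>l. l \<in> Q \<Longrightarrow> 2 \<le> (\<Sum>k\<in>T. flow m k l)"
proof -
  have fin: "finite T" using T(1) finite_subset by blast
  have W: "2 \<le> (\<Sum>k\<in>T. flow m k l)" if "k \<in> T" "l = k \<or> l = Suc k mod m" for k l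
  proof -
    have "2 \<le> flow m k l"
      using that assms(1) by (auto simp: flow_def)
    also have "\<dots> \<le> (\<Sum>k\<in>T. flow m k l)"
      by (rule member_le_sum) (use that fin flow_nonneg assms(1) in auto)
    finally show ?thesis .
  qed
  show thesis
  proof (cases "T = {..<m}")
    case True
    have "m + m * (m - 1) = m * m"
      using assms(1) by (cases m) auto
    then show ?thesis using that[of T] W True by auto
  next
    case False
    then obtain k where k: "k \<in> T" "Suc k mod m \<notin> T"
      using Suc_mod_closed_imp_all[OF T] by blast
    have "m + card T * (m - 1) \<le> m * Suc (card T)"
      by (simp add: mult.commute)
    then show ?thesis
      using that[of "insert (Suc k mod m) T"] W k T fin assms(1) by auto
  qed
qed

text \<open>
  The load that the free facilities in \<open>T\<close> carry from clients outside \<open>J\<close> is capacity lost to an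
  inequality for \<open>J\<close>.
\<close>

lemma full_facilities_slack:
  assumes "5 \<le> m" and T: "T \<subseteq> {..<m}" "T \<noteq> {}" and J: "J \<subseteq> {..<m * m}"
  shows "2 * (real m + real (card T) * (real m - 1) - real (card J)) \<le>
    real m * (\<Sum>k\<in>T. \<Sum>j\<in>{..<m * m} - J. gap_x m k j)"
proof -
  obtain Q where Q: "Q \<subseteq> {..<m}" "m + card T * (m - 1) \<le> m * card Q"
    "\<And>l. l \<in> Q \<Longrightarrow> 2 \<le> (\<Sum>k\<in>T. flow m k l)"
    using expanding_clusters[OF assms(1) T] by blast
  let ?Z = "{..<m * m} - J" and ?CQ = "{j. j < m * m \<and> j div m \<in> Q}"
  have finJ: "finite J" using J finite_subset by blast
  have "real (card ?CQ) = (\<Sum>j<m * m. if j div m \<in> Q then 1 else 0)"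
    by (simp add: sum.If_cases Int_def)
  also have "\<dots> = real m * (\<Sum>k<m. if k \<in> Q then 1 else 0)"
    by (rule sum_clusters)
  also have "\<dots> = real m * real (card Q)"
    using Q(1) by (simp add: sum.If_cases Int_absorb1)
  finally have cardCQ: "real (card ?CQ) = real m * real (card Q)" .
  have "real m + real (card T) * (real m - 1) = real (m + card T * (m - 1))"
    using assms(1) by (simp add: of_nat_diff)
  also have "\<dots> \<le> real (m * card Q)"
    using Q(2) of_nat_le_iff by blast
  finally have "real m + real (card T) * (real m - 1) - real (card J) \<le> real (card ?CQ) - real (card J)"
    by (simp add: cardCQ)
  also have "\<dots> \<le> real (card (?CQ - J))"
    using diff_card_le_card_Diff[OF finJ, of ?CQ] by linarith
  \<comment> \<open>Every client of a cluster in \<open>Q\<close> receives at least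
    \<open>2 / m\<close> from \<open>T\<close>; only the clients outside \<open>J\<close> are
    counted.\<close>
  finally have "2 * (real m + real (card T) * (real m - 1) - real (card J)) \<le> (\<Sum>j\<in>?CQ - J. 2)"
    by simp
  also have "\<dots> \<le> (\<Sum>j\<in>?CQ - J. \<Sum>k\<in>T. flow m k (j div m))"
    by (rule sum_mono) (use Q(3) in auto)
  also have "\<dots> \<le> (\<Sum>j\<in>?Z. \<Sum>k\<in>T. flow m k (j div m))"
    by (rule sum_mono2) (use assms(1) in \<open>auto intro!: sum_nonneg flow_nonneg\<close>)
  also have "\<dots> = (\<Sum>k\<in>T. \<Sum>j\<in>?Z. flow m k (j div m))"
    by (rule sum.swap)
  also have "\<dots> = real m * (\<Sum>k\<in>T. \<Sum>j\<in>?Z. gap_x m k j)"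
    unfolding sum_distrib_left
    by (intro sum.cong refl) (use T(1) assms(1) in \<open>auto simp: gap_x_def\<close>)
  finally show ?thesis .
qed

text \<open>By \<open>total\<close>, the claim says that the slacks (effective capacity minus load)
  sum up to at least \<open>l\<close> plus the terms with \<open>1 - gap_y\<close>. Free facilities
  have no such term, since their \<open>gap_y\<close> is 1.\<close>

lemma gap_eff_cap_ineq:
  fixes l :: real and c :: "nat \<Rightarrow> real"
  assumes m: "7 \<le> m" and J: "J \<subseteq> {..<m * m}" and I: "I \<subseteq> {..<2 * m}"
    and Js: "\<And>i. i \<in> I \<Longrightarrow> Js i \<subseteq> J"
    and c: "\<And>i. c i = min (real m - 1) (real (card (Js i)))"
    and total: "(\<Sum>i\<in>I. c i) = real (card J) + l" and l: "0 < l"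
  shows "(\<Sum>i\<in>I. \<Sum>j\<in>Js i. gap_x m i j) + (\<Sum>i\<in>I. max 0 (c i - l) * (1 - gap_y m i))
    \<le> real (card J)"
proof -
  define X where "X i = (\<Sum>j\<in>Js i. gap_x m i j)" for i
  define \<eta> where "\<eta> = 2 / (real m - 1)"
  have \<eta>: "0 < \<eta>" "\<eta> \<le> 1 / 2" using m by (auto simp: \<eta>_def field_simps)
  have finI: "finite I" and finJ: "finite J"
    using I J finite_subset by blast+
  have finJs: "finite (Js i)" if "i \<in> I" for i
    using Js[OF that] finJ finite_subset by blast
  have x_nonneg: "0 \<le> gap_x m i j" for i j
    using m by (simp add: gap_x_nonneg)
  have c_nonneg: "0 \<le> c i" for i using c[of i] m by simp
  have X_total: "X i \<le> (\<Sum>j<m * m. gap_x m i j)" if "i \<in> I" for i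
    unfolding X_def by (rule sum_mono2) (use Js[OF that] J x_nonneg in auto)
  have X_card: "X i \<le> real (card (Js i)) * r" if "\<And>j. gap_x m i j \<le> r" for i r
    unfolding X_def by (rule sum_bounded_above) (use that in auto)
  have X_costly: "X i \<le> c i / (real m - 1)" if "i \<in> I" "\<not> i < m" for i
  proof -
    \<comment> \<open>One bound for each argument of the minimum in \<open>c i\<close>: the whole
      load is 1, and a single client contributes at most \<open>1 / m\<close>.\<close>
    have "X i \<le> (real m - 1) / (real m - 1)"
      using X_total[OF that(1)] gap_x_costly_load[of m i] that m I by auto
    moreover have "X i \<le> real (card (Js i)) * (1 / real m)"
      by (rule X_card) (rule gap_x_costly_le[OF that(2)])
    moreover have "real (card (Js i)) * (1 / real m) \<le> real (card (Js i)) / (real m - 1)"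
      using m by (simp add: field_simps)
    ultimately show ?thesis
      by (simp add: c min_def)
  qed
  have slack_costly: "(1 - \<eta>) * c i \<le> c i - X i" if "i \<in> I" "\<not> i < m" for i
  proof -
    have "c i / (real m - 1) \<le> \<eta> * c i"
      unfolding \<eta>_def times_divide_eq_left
      using m c_nonneg[of i] by (intro divide_right_mono) auto
    then show ?thesis using X_costly[OF that] by (simp add: algebra_simps)
  qed
  have slack_small: "3 / real m * c i \<le> c i - X i"
    if "i \<in> I" "\<not> i < m \<or> real (card (Js i)) < real m - 1" for i
  proof (cases "i < m")
    case True
    \<comment> \<open>A free facility serves at most \<open>1 - 3 / m\<close> of any client, so it
      wastes at least \<open>3 / m\<close> per client when \<open>c i\<close> merely counts
      clients.\<close>
    have "X i \<le> real (card (Js i)) * (1 - 3 / real m)"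
      by (rule X_card, rule gap_x_free_le) (use m True in auto)
    moreover have "c i = real (card (Js i))" using that(2) True c[of i] by simp
    ultimately show ?thesis by (simp add: algebra_simps)
  next
    case False
    have "3 / real m \<le> 3 / 7" using m by (intro divide_left_mono) auto
    moreover have "\<eta> \<le> 1 / 2" by (rule \<eta>)
    ultimately have "3 / real m \<le> 1 - \<eta>" by linarith
    then have "3 / real m * c i \<le> (1 - \<eta>) * c i"
      using c_nonneg[of i] by (rule mult_right_mono)
    then show ?thesis using slack_costly[OF that(1) False] by linarith
  qed
  have slack_full: "(\<Sum>j\<in>{..<m * m} - J. gap_x m i j) \<le> c i - X i"
    if "i \<in> I" "i < m" "\<not> real (card (Js i)) < real m - 1" for i
  proof -
    \<comment> \<open>Here the effective capacity equals the total load, so all load from outside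
      \<open>J\<close> is slack.\<close>
    have "c i = real m - 1" using that(3) c[of i] by simp
    also have "\<dots> = (\<Sum>j<m * m. gap_x m i j)"
      using gap_x_free_load[of m i] that m by simp
    also have "\<dots> = (\<Sum>j\<in>{..<m * m} - J. gap_x m i j) + (\<Sum>j\<in>J. gap_x m i j)"
      by (rule sum.subset_diff) (use J in auto)
    finally have "c i - (\<Sum>j\<in>J. gap_x m i j) = (\<Sum>j\<in>{..<m * m} - J. gap_x m i j)" by simp
    moreover have "X i \<le> (\<Sum>j\<in>J. gap_x m i j)"
      unfolding X_def by (rule sum_mono2) (use Js[OF that(1)] finJ x_nonneg in auto)
    ultimately show ?thesis by linarith
  qed
  have slack_nonneg: "0 \<le> c i - X i" if "i \<in> I" for i
  proof -
    consider "\<not> i < m \<or> real (card (Js i)) < real m - 1"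
      | "i < m" "\<not> real (card (Js i)) < real m - 1" by blast
    then show ?thesis
    proof cases
      case 1
      have "0 \<le> 3 / real m * c i" using c_nonneg[of i] by simp
      then show ?thesis using slack_small[OF that 1] by linarith
    next
      case 2
      have "0 \<le> (\<Sum>j\<in>{..<m * m} - J. gap_x m i j)" by (intro sum_nonneg x_nonneg)
      then show ?thesis using slack_full[OF that 2] by linarith
    qed
  qed
  \<comment> \<open>Two costly facilities contributing to the inequality already save \<open>l\<close> by themselves. A single one,
    \<open>b\<close>, saves enough if \<open>l\<close> is at most half of \<open>c b\<close>; otherwise \<open>J\<close> exceeds the remaining effective
    capacity only a little, and the slack of the remaining facilities pays for what \<open>b\<close> serves.\<close>
  define B where "B = {i \<in> I. \<not> i < m \<and> l < c i}"
  have B: "B \<subseteq> I" "finite B" using finI by (auto simp: B_def)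
  have "(\<Sum>i\<in>I. max 0 (c i - l) * (1 - gap_y m i)) = (\<Sum>i\<in>B. (1 - \<eta>) * (c i - l))"
    by (rule sum.mono_neutral_cong_right) (use finI B in \<open>auto simp: B_def gap_y_def \<eta>_def\<close>)
  moreover have "(\<Sum>i\<in>I. X i) + (\<Sum>i\<in>B. (1 - \<eta>) * (c i - l)) \<le> real (card J)"
  proof -
    consider "B = {}" | b where "B = {b}" | "2 \<le> card B"
      using B(2) by (metis One_nat_def Suc_leI card_0_eq card_1_singletonE le_antisym
          linorder_not_less not_gr_zero not_less_eq_eq numeral_2_eq_2)
    then show ?thesis
    proof cases
      case 1
      \<comment> \<open>What remains is that no client of \<open>J\<close> is served more than
        once.\<close>
      have "(\<Sum>i\<in>I. X i) = (\<Sum>i\<in>I. \<Sum>j\<in>J. if j \<in> Js i then gap_x m i j else 0)"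
        unfolding X_def
        by (intro sum.cong refl sum.mono_neutral_cong_left) (use finJ Js in auto)
      also have "\<dots> \<le> (\<Sum>i\<in>I. \<Sum>j\<in>J. gap_x m i j)"
        by (intro sum_mono) (use x_nonneg in auto)
      also have "\<dots> = (\<Sum>j\<in>J. \<Sum>i\<in>I. gap_x m i j)" by (rule sum.swap)
      also have "\<dots> \<le> (\<Sum>j\<in>J. 1)"
      proof (rule sum_mono)
        fix j assume "j \<in> J"
        then have "(\<Sum>i<2 * m. gap_x m i j) = 1" using gap_x_client[of m j] J m by auto
        moreover have "(\<Sum>i\<in>I. gap_x m i j) \<le> (\<Sum>i<2 * m. gap_x m i j)"
          by (rule sum_mono2) (use I x_nonneg in auto)
        ultimately show "(\<Sum>i\<in>I. gap_x m i j) \<le> 1" by simp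
      qed
      finally show ?thesis using 1 by simp
    next
      case 3
      \<comment> \<open>Since \<open>1 - \<eta>\<close> is at least 1/2, two members of
        \<open>B\<close> suffice to subtract \<open>l\<close> once in full.\<close>
      have "1 \<le> (1 - \<eta>) * real (card B)"
        using mult_mono[of "1/2" "1 - \<eta>" 2 "real (card B)"] 3 \<eta> by simp
      then have "l \<le> (1 - \<eta>) * real (card B) * l"
        using l by simp
      moreover have "(\<Sum>i\<in>B. (1 - \<eta>) * (c i - l)) =
          (\<Sum>i\<in>B. (1 - \<eta>) * c i) - (1 - \<eta>) * real (card B) * l"
        by (simp add: sum_subtractf flip: sum_distrib_left) (simp add: right_diff_distrib)
      moreover have "(\<Sum>i\<in>B. (1 - \<eta>) * c i) \<le> (\<Sum>i\<in>B. c i - X i)"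
        by (rule sum_mono, rule slack_costly) (auto simp: B_def)
      moreover have "(\<Sum>i\<in>B. c i - X i) \<le> (\<Sum>i\<in>I. c i - X i)"
        by (rule sum_mono2) (use finI B slack_nonneg in auto)
      moreover have "(\<Sum>i\<in>I. c i - X i) = real (card J) + l - (\<Sum>i\<in>I. X i)"
        by (simp add: sum_subtractf total)
      ultimately show ?thesis by linarith
    next
      case (2 b)
      then have b: "b \<in> I" "\<not> b < m" "l < c b" by (auto simp: B_def)
      define e where "e = c b - l"
      define R where "R = (\<Sum>i\<in>I - {b}. c i - X i)"
      have R: "real (card J) + l - (\<Sum>i\<in>I. X i) = c b - X b + R"
        using sum.remove[OF finI b(1), of "\<lambda>i. c i - X i"]
        by (simp add: sum_subtractf total R_def)
      \<comment> \<open>By \<open>R\<close>, this is equivalent to the goal: \<open>card J\<close>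
        minus the total load equals \<open>e - X b + R\<close>.\<close>
      have "X b \<le> \<eta> * e + R"
      proof (cases "c b / 2 \<le> e")
        case True
        have "X b \<le> \<eta> * (c b / 2)" using X_costly[OF b(1,2)] by (simp add: \<eta>_def field_simps)
        also have "\<dots> \<le> \<eta> * e" using True \<eta> by simp
        finally show ?thesis
          using sum_nonneg[of "I - {b}" "\<lambda>i. c i - X i"] slack_nonneg by (simp add: R_def)
      next
        case False
        \<comment> \<open>\<open>T\<close> holds the free facilities at full effective capacity,
          whose slack comes from expansion along the cycle. Those in \<open>F\<close> waste a fixed
          fraction of their effective capacity.\<close>
        define T where "T = {i \<in> I. i < m \<and> \<not> real (card (Js i)) < real m - 1}"
        define F where "F = I - {b} - T"
        define v where "v = (\<Sum>i\<in>F. c i)"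
        have T: "T \<subseteq> I - {b}" "T \<subseteq> {..<m}" using b by (auto simp: T_def)
        have v: "0 \<le> v" unfolding v_def by (intro sum_nonneg c_nonneg)
        have "(\<Sum>i\<in>T. c i) = (\<Sum>i\<in>T. real m - 1)"
          by (rule sum.cong) (auto simp: T_def c)
        moreover have "(\<Sum>i\<in>I - {b}. c i) = v + (\<Sum>i\<in>T. c i)"
          unfolding v_def F_def by (rule sum.subset_diff) (use T finI in auto)
        moreover have "(\<Sum>i\<in>I. c i) = c b + (\<Sum>i\<in>I - {b}. c i)"
          by (rule sum.remove[OF finI b(1)])
        ultimately have cardJ: "real (card J) = real (card T) * (real m - 1) + v + e"
          using total by (simp add: e_def)
        have "3 / real m * v \<le> (\<Sum>i\<in>F. c i - X i)"
          unfolding v_def sum_distrib_left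
          by (rule sum_mono, rule slack_small) (auto simp: F_def T_def)
        moreover have "R = (\<Sum>i\<in>F. c i - X i) + (\<Sum>i\<in>T. c i - X i)"
          unfolding R_def F_def by (rule sum.subset_diff) (use T finI in auto)
        moreover have "(\<Sum>k\<in>T. \<Sum>j\<in>{..<m * m} - J. gap_x m k j) \<le> (\<Sum>i\<in>T. c i - X i)"
          by (rule sum_mono, rule slack_full) (auto simp: T_def)
        ultimately have R_ge:
          "3 / real m * v + (\<Sum>k\<in>T. \<Sum>j\<in>{..<m * m} - J. gap_x m k j) \<le> R" by linarith
        have "X b \<le> R"
        proof (cases "T = {}")
          case True
          \<comment> \<open>Now \<open>card J = v + e\<close>, and \<open>e\<close> is below half of
            \<open>card (Js b)\<close>, so \<open>F\<close> has slack at least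
            \<open>3 / (2 * m)\<close> per client of \<open>Js b\<close>, while \<open>b\<close>
            serves at most \<open>1 / m\<close> of each.\<close>
          have "card (Js b) \<le> card J" using Js[OF b(1)] finJ by (rule card_mono[rotated])
          then have "real (card (Js b)) / 2 \<le> v"
            using cardJ True False c[of b] by simp
          then have "3 / real m * (real (card (Js b)) / 2) \<le> 3 / real m * v"
            by (rule mult_left_mono) simp
          moreover have "real (card (Js b)) * (1 / real m) \<le> 3 / real m * (real (card (Js b)) / 2)"
            using m by (simp add: field_simps)
          moreover have "X b \<le> real (card (Js b)) * (1 / real m)"
            by (rule X_card) (rule gap_x_costly_le[OF b(2)])
          ultimately show ?thesis using R_ge True by simp
        next
          case Tne: False
          \<comment> \<open>Expansion loses \<open>2 * v\<close>, which the slack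
            \<open>3 * v / m\<close> of \<open>F\<close> outweighs after scaling by
            \<open>m\<close>. As \<open>2 * e \<le> m\<close>, the total slack reaches 1, the whole
            load of \<open>b\<close>.\<close>
          have "2 * (real m - v - e) \<le>
            real m * (\<Sum>k\<in>T. \<Sum>j\<in>{..<m * m} - J. gap_x m k j)"
            using full_facilities_slack[of m T J] T Tne J m cardJ by simp
          also have "\<dots> \<le> real m * (R - 3 / real m * v)"
            using R_ge by (intro mult_left_mono) auto
          also have "\<dots> = real m * R - 3 * v" using m by (simp add: field_simps)
          finally have "2 * real m + v - 2 * e \<le> real m * R" by simp
          moreover have "2 * e \<le> real m" using False c[of b] by simp
          ultimately have "real m * 1 \<le> real m * R" using v by simp
          then have "1 \<le> R" using m by simp
          moreover have "X b \<le> 1"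
            using X_total[OF b(1)] gap_x_costly_load[of m b] b m I by auto
          ultimately show ?thesis by linarith
        qed
        moreover have "0 \<le> \<eta> * e" using \<eta> b by (simp add: e_def)
        ultimately show ?thesis by linarith
      qed
      then show ?thesis using R 2 by (simp add: e_def algebra_simps)
    qed
  qed
  ultimately show ?thesis by (simp add: X_def)
qed

lemma eff_cap_relaxation_gap:
  assumes "7 \<le> m"
  shows "eff_cap_relaxation (gap_cfl m) (gap_x m) (gap_y m)"
  unfolding eff_cap_relaxation_def eff_cap_ineqs_def
proof (intro conjI allI impI, goal_cases)
  case 1
  show ?case using assms by (simp add: lp_classic_gap)
next
  case (2 J I Js l)
  have "eff_cap (gap_cfl m) Js i = min (real m - 1) (real (card (Js i)))" for i
    using assms by (simp add: eff_cap_def total_demand_def of_nat_diff)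
  then show ?case
    using gap_eff_cap_ineq[OF assms, of J I Js "eff_cap (gap_cfl m) Js" l] 2
    by (simp add: total_demand_def)
qed

section \<open>Admissibility of the instance\<close>

lemma metric_costs_gap:
  assumes "0 < m"
  shows "metric_costs (gap_cfl m)"
proof -
  define pos :: "nat + nat \<Rightarrow> real"
    where "pos = case_sum (\<lambda>i. real (i mod m)) (\<lambda>j. real (j div m))"
  define D where "D p q = (if p = q then 0 else 1 / real m + \<bar>pos p - pos q\<bar>)" for p q
  have pos_D: "0 < 1 / real m + \<bar>r\<bar>" for r
    using assms by (simp add: add_pos_nonneg)
  have "Metric_space S D" for S
  proof
    show "0 \<le> D p q" for p q using less_imp_le[OF pos_D] by (simp add: D_def)
    show "D p q = D q p" for p q by (auto simp: D_def)
    show "D p q = 0 \<longleftrightarrow> p = q" for p q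
      using pos_D[of "pos p - pos q"] by (auto simp: D_def)
    show "D p r \<le> D p q + D q r" for p q r
    proof -
      have "\<bar>pos p - pos r\<bar> \<le> 1 / real m + \<bar>pos p - pos q\<bar> + \<bar>pos q - pos r\<bar>"
        using pos_D[of 0] by linarith
      then show ?thesis using pos_D[of 0] by (auto simp: D_def)
    qed
  qed
  then show ?thesis
    unfolding metric_costs_def by (intro exI[of _ D]) (simp add: D_def pos_def)
qed

lemma uniform_unit_cfl_gap:
  assumes "2 \<le> m"
  shows "uniform_unit_cfl (gap_cfl m)"
proof -
  have "cfl_instance (gap_cfl m)"
    using assms metric_costs_gap[of m] by (simp add: cfl_instance_def)
  moreover have "\<exists>U::nat. U > 0 \<and> (\<forall>i\<in>facilities (gap_cfl m). capacity (gap_cfl m) i = real U)"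
    using assms by (intro exI[of _ "m - 1"]) simp
  ultimately show ?thesis by (simp add: uniform_unit_cfl_def)
qed

text \<open>Sending the first client of each cluster to the costly facility leaves exactly
  \<open>m - 1\<close> for the free one.\<close>

lemma cfl_solution_gap:
  assumes "2 \<le> m"
  shows "cfl_solution (gap_cfl m) {..<2 * m}
    (\<lambda>j. if j mod m = 0 then m + j div m else j div m)" (is "cfl_solution _ _ ?\<sigma>")
proof -
  have "real (card {j. j < m * m \<and> ?\<sigma> j = i}) \<le> real (m - 1)" if "i < 2 * m" for i
  proof (cases "i < m")
    case True
    have "{j. j < m * m \<and> ?\<sigma> j = i} \<subseteq> (\<lambda>r. i * m + r) ` {1..<m}"
    proof
      fix j assume "j \<in> {j. j < m * m \<and> ?\<sigma> j = i}"
      then have "j mod m \<noteq> 0" "j div m = i" using True by (auto split: if_splits)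
      then show "j \<in> (\<lambda>r. i * m + r) ` {1..<m}"
        using assms by (intro image_eqI[of _ _ "j mod m"]) auto
    qed
    then have "card {j. j < m * m \<and> ?\<sigma> j = i} \<le> card {1..<m}"
      using surj_card_le by blast
    then show ?thesis by simp
  next
    case False
    have "{j. j < m * m \<and> ?\<sigma> j = i} \<subseteq> {(i - m) * m}"
    proof
      fix j assume "j \<in> {j. j < m * m \<and> ?\<sigma> j = i}"
      then have j: "j < m * m" "?\<sigma> j = i" by auto
      have "j div m < m" using j(1) by (rule cluster_less)
      then have "j mod m = 0" "j div m = i - m" using j False by (auto split: if_splits)
      then show "j \<in> {(i - m) * m}" using div_mult_mod_eq[of j m] by simp
    qed
    then have "card {j. j < m * m \<and> ?\<sigma> j = i} \<le> card {(i - m) * m}"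
      by (rule card_mono[rotated]) simp
    then show ?thesis using assms by simp
  qed
  moreover have "?\<sigma> j < 2 * m" if "j < m * m" for j
    using cluster_less[OF that] by simp
  ultimately show ?thesis
    unfolding cfl_solution_def by auto
qed

section \<open>Bounds on the value of the relaxation\<close>

lemma lp_cost_gap_le:
  assumes "7 \<le> m"
  shows "lp_cost (gap_cfl m) (gap_x m) (gap_y m) \<le> 8 * real m"
proof -
  have m: "3 \<le> m" "0 < m" using assms by auto
  have "(\<Sum>i<2 * m. open_cost (gap_cfl m) i * gap_y m i) = real m * (real m * (2 / (real m - 1)))"
    by (simp add: sum_facilities gap_y_def)
  also have "\<dots> \<le> real m * 3"
    using assms by (intro mult_left_mono) (auto simp: field_simps)
  finally have opening_cost: "(\<Sum>i<2 * m. open_cost (gap_cfl m) i * gap_y m i) \<le> 3 * real m" by simp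
  have "(\<Sum>i<2 * m. \<Sum>j<m * m. 1 / real m * gap_x m i j)
      = (\<Sum>j<m * m. \<Sum>i<2 * m. 1 / real m * gap_x m i j)"
    by (rule sum.swap)
  also have "\<dots> = (\<Sum>j<m * m. 1 / real m)"
    by (intro sum.cong refl) (use gap_x_client[OF m(1)] in \<open>simp flip: sum_divide_distrib\<close>)
  finally have local_cost: "(\<Sum>i<2 * m. \<Sum>j<m * m. 1 / real m * gap_x m i j) = real m"
    using m by simp
  let ?d = "\<lambda>i j. \<bar>real (i mod m) - real (j div m)\<bar>"
  have free: "(\<Sum>j<m * m. ?d k j * gap_x m k j) = 2 * \<bar>real k - real (Suc k mod m)\<bar>" if "k < m" for k
  proof -
    have "(\<Sum>j<m * m. ?d k j * gap_x m k j) =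
        (\<Sum>j<m * m. \<bar>real k - real (j div m)\<bar> * flow m k (j div m) / real m)"
      using that by (simp add: gap_x_def)
    also have "\<dots> = (\<Sum>l<m. \<bar>real k - real l\<bar> * flow m k l)"
      using sum_clusters[where g = "\<lambda>l. \<bar>real k - real l\<bar> * flow m k l / real m"] m
      by (simp flip: sum_divide_distrib)
    also have "\<dots> = (\<Sum>l<m. if Suc k mod m = l then 2 * \<bar>real k - real l\<bar> else 0)"
      by (intro sum.cong) (auto simp: flow_def)
    finally show ?thesis using m by simp
  qed
  have costly: "(\<Sum>j<m * m. ?d (m + k) j * gap_x m (m + k) j) = 0" if "k < m" for k
    using that by (intro sum.neutral) (auto simp: gap_x_def)
  \<comment> \<open>All arcs of the cycle have length 1 except the closing one, from
    \<open>m - 1\<close> back to 0.\<close>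
  have "\<bar>real k - real (Suc k mod m)\<bar> \<le> 1 + (if k = m - 1 then real m else 0)" if "k < m" for k
    using that m by (cases "Suc k = m") auto
  then have "(\<Sum>k<m. \<bar>real k - real (Suc k mod m)\<bar>) \<le>
      (\<Sum>k<m. 1 + (if k = m - 1 then real m else 0))"
    by (intro sum_mono) auto
  also have "\<dots> = 2 * real m"
    using m by (simp add: sum.distrib)
  finally have "(\<Sum>i<2 * m. \<Sum>j<m * m. ?d i j * gap_x m i j) \<le> 4 * real m"
    using free costly by (simp add: sum_facilities del: mod_less flip: sum_distrib_left)
  \<comment> \<open>The total is \<open>3 * m\<close> for opening, \<open>m\<close> for the offsets
    \<open>1 / m\<close>, and \<open>4 * m\<close> for the circulation.\<close>
  then show ?thesis
    using opening_cost local_cost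
    by (simp add: lp_cost_def distrib_right sum.distrib)
qed

text \<open>Each of the \<open>m * m\<close> clients pays at least \<open>1 / m\<close>. This keeps
  the relaxation value positive, as \<open>integrality_gap\<close> demands.\<close>

lemma lp_cost_gap_ge:
  assumes "0 < m" "lp_classic (gap_cfl m) x y"
  shows "real m \<le> lp_cost (gap_cfl m) x y"
proof -
  have x: "0 \<le> x i j" if "i < 2 * m" "j < m * m" for i j
    using assms(2) that by (simp add: lp_classic_def)
  have "real m = (\<Sum>j<m * m. 1 / real m * (\<Sum>i<2 * m. x i j))"
    using assms by (simp add: lp_classic_def)
  also have "\<dots> = (\<Sum>i<2 * m. \<Sum>j<m * m. 1 / real m * x i j)"
    by (subst sum.swap) (simp only: sum_distrib_left)
  also have "\<dots> \<le> (\<Sum>i<2 * m. \<Sum>j<m * m. conn (gap_cfl m) i j * x i j)"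
    by (intro sum_mono mult_right_mono) (use x in auto)
  also have "\<dots> \<le> lp_cost (gap_cfl m) x y"
    using assms(2) by (auto simp: lp_cost_def lp_classic_def intro!: sum_nonneg)
  finally show ?thesis .
qed

section \<open>Lower bound for integral solutions\<close>

text \<open>
  Every cluster has one client more than a free facility can serve. Hence the transport cost
  dominates the total value of any potential vanishing at the open costly facilities (weak
  transport duality).
\<close>

lemma cfl_cost_gap_ge_potential:
  fixes \<phi> :: "nat \<Rightarrow> real"
  assumes m: "0 < m" and sol: "cfl_solution (gap_cfl m) S \<sigma>"
    and nonneg: "\<And>k. 0 \<le> \<phi> k"
    and lipschitz: "\<And>k l. \<phi> k - \<phi> l \<le> \<bar>real k - real l\<bar>"
    and zero: "\<And>i. i \<in> S \<Longrightarrow> m \<le> i \<Longrightarrow> \<phi> (i mod m) = 0"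
  shows "real m * real (card {i \<in> S. m \<le> i}) + (\<Sum>k<m. \<phi> k) \<le> cfl_cost (gap_cfl m) S \<sigma>"
proof -
  have S: "S \<subseteq> {..<2 * m}" and \<sigma>: "\<And>j. j < m * m \<Longrightarrow> \<sigma> j \<in> S"
    and load: "\<And>i. i \<in> S \<Longrightarrow> card {j. j < m * m \<and> \<sigma> j = i} \<le> m - 1"
    using sol by (auto simp: cfl_solution_def)
  have finS: "finite S" using S finite_subset by blast
  have opening_cost: "(\<Sum>i\<in>S. open_cost (gap_cfl m) i) = real m * real (card {i \<in> S. m \<le> i})"
    using finS by (simp add: sum.If_cases Int_def linorder_not_less Collect_neg_eq)
  have "(\<Sum>j<m * m. \<phi> (\<sigma> j mod m)) =
      (\<Sum>i\<in>S. \<Sum>j\<in>{j \<in> {..<m * m}. \<sigma> j = i}. \<phi> (\<sigma> j mod m))"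
    by (rule sum.group[symmetric]) (use finS \<sigma> in auto)
  also have "\<dots> = (\<Sum>i\<in>S. real (card {j. j < m * m \<and> \<sigma> j = i}) * \<phi> (i mod m))"
    by (intro sum.cong refl) simp
  also have "\<dots> \<le> (\<Sum>i\<in>S. real (m - 1) * \<phi> (i mod m))"
    by (intro sum_mono mult_right_mono nonneg) (use load in auto)
  \<comment> \<open>Open costly facilities drop out by \<open>zero\<close>; for the free ones
    \<open>i mod m\<close> is \<open>i\<close>.\<close>
  also have "\<dots> = (\<Sum>i\<in>S \<inter> {..<m}. real (m - 1) * \<phi> i)"
    by (rule sum.mono_neutral_cong_right) (use finS zero in \<open>force+\<close>)
  also have "\<dots> \<le> (\<Sum>k<m. real (m - 1) * \<phi> k)"
    by (rule sum_mono2) (use nonneg in auto)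
  also have "\<dots> = real m * (\<Sum>k<m. \<phi> k) - (\<Sum>k<m. \<phi> k)"
    using m by (simp add: of_nat_diff left_diff_distrib sum_subtractf flip: sum_distrib_left)
  finally have "(\<Sum>k<m. \<phi> k) \<le> real m * (\<Sum>k<m. \<phi> k) - (\<Sum>j<m * m. \<phi> (\<sigma> j mod m))"
    by linarith
  also have "\<dots> = (\<Sum>j<m * m. \<phi> (j div m) - \<phi> (\<sigma> j mod m))"
    by (simp add: sum_subtractf sum_clusters)
  also have "\<dots> \<le> (\<Sum>j<m * m. conn (gap_cfl m) (\<sigma> j) j)"
  proof (rule sum_mono)
    fix j
    have "\<phi> (j div m) - \<phi> (\<sigma> j mod m) \<le> \<bar>real (j div m) - real (\<sigma> j mod m)\<bar>"
      by (rule lipschitz)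
    then show "\<phi> (j div m) - \<phi> (\<sigma> j mod m) \<le> conn (gap_cfl m) (\<sigma> j) j"
      by (simp add: abs_minus_commute add_increasing)
  qed
  finally show ?thesis using opening_cost by (simp add: cfl_cost_def)
qed

text \<open>The potential is the distance to the nearest cluster with an open costly facility,
  capped at \<open>q\<close>. With \<open>t\<close> such facilities it equals \<open>q\<close>
  outside at most \<open>2 * q * t\<close> clusters.\<close>

lemma cfl_cost_gap_ge:
  assumes q: "0 < q" and sol: "cfl_solution (gap_cfl (q * q)) S \<sigma>"
  shows "real q ^ 3 / 2 \<le> cfl_cost (gap_cfl (q * q)) S \<sigma>"
proof -
  define m where "m = q * q"
  have m: "0 < m" using q by (simp add: m_def)
  have finS: "finite S"
    using sol finite_subset by (auto simp: cfl_solution_def)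
  define P where "P = (\<lambda>i. i mod m) ` {i \<in> S. m \<le> i}"
  define t where "t = card {i \<in> S. m \<le> i}"
  have P: "finite P" "card P \<le> t"
    unfolding P_def t_def using finS by (auto intro: card_image_le)
  \<comment> \<open>The cap \<open>q\<close> also keeps the set nonempty when no costly facility is
    open.\<close>
  define \<phi> where "\<phi> k = Min (insert (real q) ((\<lambda>p. \<bar>real k - real p\<bar>) ` P))" for k
  have \<phi>_nonneg: "0 \<le> \<phi> k" for k using P by (simp add: \<phi>_def)
  have \<phi>_zero: "\<phi> k = 0" if "k \<in> P" for k
  proof (rule antisym[OF _ \<phi>_nonneg])
    show "\<phi> k \<le> 0" unfolding \<phi>_def by (rule Min_le) (use P that in auto)
  qed
  have "\<phi> k - \<phi> l \<le> \<bar>real k - real l\<bar>" for k l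
  proof -
    have "\<phi> k - \<bar>real k - real l\<bar> \<le> \<phi> l"
      unfolding \<phi>_def[of l]
    proof (rule Min.boundedI)
      fix a assume a: "a \<in> insert (real q) ((\<lambda>p. \<bar>real l - real p\<bar>) ` P)"
      show "\<phi> k - \<bar>real k - real l\<bar> \<le> a"
      proof (cases "a = real q")
        case True
        have "\<phi> k \<le> real q" unfolding \<phi>_def by (rule Min_le) (use P in auto)
        then show ?thesis using True by linarith
      next
        case False
        then obtain p where p: "p \<in> P" "a = \<bar>real l - real p\<bar>" using a by auto
        have "\<phi> k \<le> \<bar>real k - real p\<bar>" unfolding \<phi>_def by (rule Min_le) (use P p in auto)
        then show ?thesis using p(2) by linarith
      qed
    qed (use P in auto)
    then show ?thesis by linarith
  qed
  then have cost: "real m * real t + (\<Sum>k<m. \<phi> k) \<le> cfl_cost (gap_cfl m) S \<sigma>"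
    unfolding t_def
    using cfl_cost_gap_ge_potential[OF m, of S \<sigma> \<phi>] sol \<phi>_nonneg \<phi>_zero
    by (simp add: m_def[symmetric] P_def)
  \<comment> \<open>\<open>N\<close> contains every cluster closer than \<open>q\<close> to
    \<open>P\<close>. Truncation of \<open>p - q\<close> at 0 only shortens an interval.\<close>
  define N where "N = (\<Union>p\<in>P. {p - q..<p + q})"
  have "card N \<le> (\<Sum>p\<in>P. card {p - q..<p + q})"
    unfolding N_def by (rule card_UN_le[OF P(1)])
  also have "\<dots> \<le> (\<Sum>p\<in>P. 2 * q)" by (rule sum_mono) auto
  also have "\<dots> \<le> t * (2 * q)" using P(2) by simp
  finally have N: "card N \<le> t * (2 * q)" .
  have "real q \<le> \<phi> k" if "k \<notin> N" for k
  proof -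
    have "real q \<le> \<bar>real k - real p\<bar>" if "p \<in> P" for p
    proof -
      have "k < p - q \<or> p + q \<le> k" using \<open>k \<notin> N\<close> that by (auto simp: N_def not_less)
      then show ?thesis by linarith
    qed
    then show ?thesis unfolding \<phi>_def using P by simp
  qed
  then have "(\<Sum>k\<in>{..<m} - N. real q) \<le> (\<Sum>k\<in>{..<m} - N. \<phi> k)"
    by (intro sum_mono) auto
  also have "\<dots> \<le> (\<Sum>k<m. \<phi> k)"
    by (rule sum_mono2) (use \<phi>_nonneg in auto)
  finally have "real (card ({..<m} - N)) * real q \<le> (\<Sum>k<m. \<phi> k)" by simp
  moreover have "real m - real t * (2 * real q) \<le> real (card ({..<m} - N))"
  proof -
    have "finite N" using P by (simp add: N_def)
    then have "m - card N \<le> card ({..<m} - N)" using diff_card_le_card_Diff[of N "{..<m}"] by simp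
    then have "m \<le> card ({..<m} - N) + t * (2 * q)" using N by linarith
    then have "real m \<le> real (card ({..<m} - N) + t * (2 * q))" by (rule of_nat_mono)
    then show ?thesis by simp
  qed
  ultimately have "(real m - real t * (2 * real q)) * real q \<le> (\<Sum>k<m. \<phi> k)"
    by (meson mult_right_mono of_nat_0_le_iff order_trans)
  moreover have "0 \<le> (\<Sum>k<m. \<phi> k)" by (intro sum_nonneg \<phi>_nonneg)
  \<comment> \<open>The potential sum is at least half of itself, hence at least
    \<open>q ^ 3 / 2 - q * q * t\<close>; the opening cost cancels the last term.\<close>
  ultimately show ?thesis
    using cost by (simp add: m_def algebra_simps power3_eq_cube)
qed

section \<open>The unbounded ratio\<close>

lemma integrality_gap_uniform_ge:
  assumes "3 \<le> q"
  shows "ereal (real q / 16) \<le> integrality_gap eff_cap_relaxation {A. uniform_unit_cfl A}"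
proof -
  define m where "m = q * q"
  have m: "7 \<le> m" using mult_le_mono[OF assms assms] by (simp add: m_def)
  let ?A = "gap_cfl m" and ?r = "relaxation_opt eff_cap_relaxation (gap_cfl m)"
  have "?r \<le> ereal (lp_cost ?A (gap_x m) (gap_y m))"
    unfolding relaxation_opt_def using eff_cap_relaxation_gap[OF m] by (auto intro!: Inf_lower)
  then have upper: "?r \<le> ereal (8 * real m)"
    using lp_cost_gap_le[OF m] by (meson ereal_less_eq(3) order_trans)
  have lower: "ereal (real m) \<le> ?r"
    unfolding relaxation_opt_def
    by (rule Inf_greatest) (use m lp_cost_gap_ge in \<open>auto simp: eff_cap_relaxation_def\<close>)
  obtain r where r: "?r = ereal r" using lower upper by (cases ?r) auto
  have r_bounds: "0 < r" "r \<le> 8 * real m" using lower upper m by (auto simp: r)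
  have opt: "ereal (real q ^ 3 / 2) \<le> cfl_opt ?A"
    unfolding cfl_opt_def
    by (rule Inf_greatest) (use assms cfl_cost_gap_ge[of q] in \<open>auto simp: m_def\<close>)
  \<comment> \<open>The ratio of the bounds \<open>q ^ 3 / 2\<close> and \<open>8 * q * q\<close> is
    \<open>q / 16\<close>.\<close>
  have "real q / 16 * r \<le> real q / 16 * (8 * real m)"
    using r_bounds by (intro mult_left_mono) auto
  also have "\<dots> = real q ^ 3 / 2" by (simp add: m_def power3_eq_cube)
  finally have "ereal (real q / 16) \<le> ereal (real q ^ 3 / 2) / ?r"
    using r_bounds by (simp add: r field_simps)
  also have "\<dots> \<le> cfl_opt ?A / ?r"
    using opt r_bounds by (intro ereal_divide_right_mono) (auto simp: r)
  also have "\<dots> \<le> integrality_gap eff_cap_relaxation {A. uniform_unit_cfl A}"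
    unfolding integrality_gap_def
  proof (rule SUP_upper, intro CollectI conjI)
    show "uniform_unit_cfl ?A" using m by (simp add: uniform_unit_cfl_gap)
    show "\<exists>S \<sigma>. cfl_solution ?A S \<sigma>" using cfl_solution_gap[of m] m by (intro exI) simp
    show "0 < ?r" using r r_bounds by simp
  qed
  finally show ?thesis .
qed

theorem theorem2:
  shows "integrality_gap eff_cap_relaxation {A. cfl_instance A} = \<infinity> \<and>
         integrality_gap eff_cap_relaxation {A. uniform_unit_cfl A} = \<infinity>"
proof
  show uniform: "integrality_gap eff_cap_relaxation {A. uniform_unit_cfl A} = \<infinity>"
  proof (rule ereal_top)
    fix B :: real
    obtain q where q: "16 * B \<le> real q" using real_arch_simple by blast
    have "ereal B \<le> ereal (real (max 3 q) / 16)" using q by simp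
    then show "ereal B \<le> integrality_gap eff_cap_relaxation {A. uniform_unit_cfl A}"
      using integrality_gap_uniform_ge[of "max 3 q"] by (meson max.cobounded1 order_trans)
  qed
  have "integrality_gap eff_cap_relaxation {A. uniform_unit_cfl A}
      \<le> integrality_gap eff_cap_relaxation {A. cfl_instance A}"
    unfolding integrality_gap_def
    by (rule SUP_subset_mono) (auto simp: uniform_unit_cfl_def)
  then show "integrality_gap eff_cap_relaxation {A. cfl_instance A} = \<infinity>"
    by (simp add: uniform)
qed

end
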